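(* Let $\lambda\in(0,\infty)$, let $n$ be a positive integer, and let $f(t)$ be a function defined for $t\ge 0$. If $f,f^{(1)},\dots,f^{(n-1)}$ are continuous on $(0,\infty)$ and are of degenerate exponential order, and if $f^{(n)}(t)$ is piecewise continuous on $(0,\infty)$, then, for $s$ suitably restricted to guarantee the convergence of the relevant degenerate Laplace transforms, $$\mathcal{L}_{\lambda}\left(f^{(n)}(t)\right)=s(s+\lambda)\cdots(s+(n-1)\lambda)\,\mathcal{L}_{\lambda}\left((1+\lambda t)^{-n}f(t)\right)-\sum_{i=0}^{n-1}f^{(i)}(0)\left(\prod_{l=1}^{n-i-1}\bigl(s+(l-1)\lambda\bigr)\right),$$ where $f^{(n)}(t)=\left(\frac{d}{dt}\right)^{n}f(t)$.
   Context: For $\lambda\in(0,\infty)$ and a function $g(t)$ defined for $t\ge 0$, the degenerate Laplace transform of $g$ is the function of $s$ given by $$\mathcal{L}_{\lambda}(g(t))=\int_0^{\infty}(1+\lambda t)^{-\frac{s}{\lambda}}g(t)\,dt,$$ if the integral converges. A function $g(t)$ is said to be of degenerate exponential order $C$ if there exist $C,M>0$ and $T>0$ such that $|g(t)|\le M(1+\lambda t)^{\frac{C}{\lambda}}$ for all $t>T$; it is of degenerate exponential order if this holds for some $C$. Here $f^{(0)}=f$, and an empty product equals $1$.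
   Formalization: Continuity of f, f^(1), ..., f^(n-1) is required on [0,∞), with one-sided derivatives at 0, instead of only on (0,∞); otherwise the claim fails, e.g. for n=1, f(0)=1 and f(t)=0 for t>0. *)

theory Defs
  imports "HOL-Analysis.Analysis"
begin

text \<open>
  The integral over \<open>{0..}\<close> is the Henstock--Kurzweil integral. By Hake's theorem it covers
  improper, possibly only conditionally convergent, integrals, as intended by
  ``if the integral converges''.
\<close>

definition deg_laplace_kernel :: "real \<Rightarrow> complex \<Rightarrow> real \<Rightarrow> complex" where
  "deg_laplace_kernel lam s t = complex_of_real (1 + lam * t) powr (- (s / complex_of_real lam))"

definition deg_laplace_converges :: "real \<Rightarrow> (real \<Rightarrow> complex) \<Rightarrow> complex \<Rightarrow> bool" where
  "deg_laplace_converges lam g s \<longleftrightarrow> (\<lambda>t. deg_laplace_kernel lam s t * g t) integrable_on {0..}"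

definition deg_laplace :: "real \<Rightarrow> (real \<Rightarrow> complex) \<Rightarrow> complex \<Rightarrow> complex" where
  "deg_laplace lam g s = integral {0..} (\<lambda>t. deg_laplace_kernel lam s t * g t)"

definition deg_exp_order_of :: "real \<Rightarrow> real \<Rightarrow> (real \<Rightarrow> complex) \<Rightarrow> bool" where
  "deg_exp_order_of lam C g \<longleftrightarrow>
     C > 0 \<and> (\<exists>M>0. \<exists>T>0. \<forall>t>T. norm (g t) \<le> M * (1 + lam * t) powr (C / lam))"

definition deg_exp_order :: "real \<Rightarrow> (real \<Rightarrow> complex) \<Rightarrow> bool" where
  "deg_exp_order lam g \<longleftrightarrow> (\<exists>C. deg_exp_order_of lam C g)"

text \<open>
  Functions are given on \<open>{0..}\<close>, so the derivative is two-sided at \<open>t > 0\<close> and one-sided at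
  \<open>0\<close>. Where the derivative does not exist, \<^const>\<open>vector_derivative\<close> is an unspecified value.
\<close>

definition half_line_deriv :: "(real \<Rightarrow> complex) \<Rightarrow> real \<Rightarrow> complex" where
  "half_line_deriv g t = vector_derivative g (at t within {0..})"

abbreviation nth_deriv :: "nat \<Rightarrow> (real \<Rightarrow> complex) \<Rightarrow> real \<Rightarrow> complex" where
  "nth_deriv k f \<equiv> (half_line_deriv ^^ k) f"

text \<open>
  Piecewise continuity on \<open>(0,\<infinity>)\<close> of a function \<open>g\<close> that is meaningful only on \<open>D\<close>: in each
  compact subinterval of \<open>(0,\<infinity>)\<close> it is defined and continuous except at finitely many points,
  and all one-sided limits exist in the complex plane. Nothing is required at \<open>0\<close>. The set \<open>D\<close> is
  needed because the highest derivative may fail to exist at isolated points; were it to exist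
  everywhere, the Darboux property would force it to be continuous.
\<close>

definition piecewise_continuous_pos :: "real set \<Rightarrow> (real \<Rightarrow> complex) \<Rightarrow> bool" where
  "piecewise_continuous_pos D g \<longleftrightarrow>
     (\<forall>a b. 0 < a \<longrightarrow> finite {t \<in> {a..b}. t \<notin> D \<or> \<not> isCont g t}) \<and>
     (\<forall>t>0. (\<exists>l. (g \<longlongrightarrow> l) (at_left t)) \<and> (\<exists>r. (g \<longlongrightarrow> r) (at_right t)))"

end

theory Submission
  imports Defs
begin

text \<open>
  Write \<open>K\<^sub>s(t) = (1 + \<lambda>t) powr (-s/\<lambda>)\<close>, so that \<open>K\<^sub>s' = -s K\<close> with \<open>K\<close> taken at \<open>s + \<lambda>\<close>. Put
  \<open>y\<^sub>k(x) = \<integral>\<^sub>0\<^sup>x K f\<^sup>(\<^sup>k\<^sup>)\<close> with \<open>K\<close> taken at \<open>s + (n - k)\<lambda>\<close>. Integration by parts gives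
  \<open>y\<^sub>k\<^sub>+\<^sub>1 = (1 + \<lambda>x) y\<^sub>k' + r\<^sub>k y\<^sub>k - f\<^sup>(\<^sup>k\<^sup>)(0)\<close> with \<open>r\<^sub>k = s + (n - k - 1)\<lambda>\<close>, where the first summand is
  the boundary term at \<open>x\<close>. If it could be dropped in the limit, solving the recursion from
  \<open>y\<^sub>0\<close> to \<open>y\<^sub>n\<close> would give the claimed formula.

  When \<open>Re s\<close> is large, the exponential order makes every boundary term vanish. This also
  proves the convergence statement, since it bounds the integrands that remain by a multiple of \<open>(1 + \<lambda>t)\<^sup>-\<^sup>2\<close>.
  For the other \<open>s\<close> the convergence of the two extreme transforms says nothing
  about the intermediate terms, which may well diverge one by one. The formula still
  holds. In the variable \<open>u\<close> with \<open>1 + \<lambda>x = exp (\<lambda>u)\<close> the operator \<open>(1 + \<lambda>x) d/dx\<close> is plain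
  differentiation \<open>D\<close>, so that up to constants \<open>y\<^sub>n = (D + r\<^sub>n\<^sub>-\<^sub>1) \<dots> (D + r\<^sub>0) y\<^sub>0\<close>. If both \<open>y\<^sub>0\<close> and
  \<open>y\<^sub>n\<close> have limits at infinity, these limits are related as if all derivatives tended to zero:
  averaging against exponential weights turns the factors \<open>D + r\<close> into finite
  differences, which act on limits in the obvious way. This is
  \<open>differential_chain_limit\<close>, the main tool of the proof.

  The exceptional points of \<open>f\<^sup>(\<^sup>n\<^sup>)\<close> may accumulate at \<open>0\<close>, and \<open>f\<^sup>(\<^sup>n\<^sup>)\<close> need not be absolutely
  integrable there. The last integration by parts therefore rests on the fundamental theorem
  of calculus for the Henstock--Kurzweil integral with countably many exceptional points,
  \<open>fundamental_theorem_of_calculus_countable\<close>.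
\<close>

section \<open>The fundamental theorem of calculus with countably many exceptions\<close>

text \<open>
  In the use below, \<open>\<phi>\<close> numbers the exceptional tags of a tagged division and records on which
  side of its tag an interval lies; so each power of one half occurs at most twice.
\<close>

lemma sum_half_powers_le_two:
  fixes \<phi> :: "'a \<Rightarrow> nat \<times> bool"
  assumes "finite A" "inj_on \<phi> A"
  shows "(\<Sum>z\<in>A. (1/2::real) ^ Suc (fst (\<phi> z))) \<le> 2"
proof -
  obtain N where N: "fst ` \<phi> ` A \<subseteq> {..N}"
    using assms(1) by (meson finite_imageI finite_nat_iff_bounded_le)
  have "(\<Sum>z\<in>A. (1/2::real) ^ Suc (fst (\<phi> z))) = (\<Sum>y\<in>\<phi> ` A. (1/2) ^ Suc (fst y))"
    using assms(2) by (simp add: sum.reindex)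
  also have "\<dots> \<le> (\<Sum>y\<in>{..N} \<times> (UNIV :: bool set). (1/2) ^ Suc (fst y))"
    by (rule sum_mono2) (use N in \<open>auto simp: image_subset_iff mem_Times_iff\<close>)
  also have "\<dots> = 2 * (\<Sum>i\<le>N. (1/2) ^ Suc i)"
    by (simp add: sum.cartesian_product' UNIV_bool sum_distrib_left)
  also have "\<dots> \<le> 2 * 1"
    using sum_le_suminf[OF sums_summable[OF power_half_series], of "{..N}"]
      sums_unique[OF power_half_series]
    by (intro mult_left_mono) auto
  finally show ?thesis by simp
qed

text \<open>
  Two nondegenerate intervals extending from the same tag to the same side overlap. A tag
  therefore belongs to at most two nondegenerate intervals.
\<close>

lemma tagged_division_same_tag:
  assumes p: "p tagged_division_of {a..b::real}"
    and 1: "(x, K) \<in> p" "Inf K < Sup K" and 2: "(x, L) \<in> p" "Inf L < Sup L"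
    and side: "Inf K < x \<longleftrightarrow> Inf L < x"
  shows "K = L"
proof (rule ccontr)
  assume "K \<noteq> L"
  then have disj: "interior K \<inter> interior L = {}"
    using tagged_division_ofD(5)[OF p 1(1) 2(1)] by blast
  obtain u v where K: "K = {u..v}"
    using tagged_division_ofD(4)[OF p 1(1)] by (metis box_real(2))
  obtain s t where L: "L = {s..t}"
    using tagged_division_ofD(4)[OF p 2(1)] by (metis box_real(2))
  have x: "u \<le> x" "x \<le> v" "s \<le> x" "x \<le> t"
    using tagged_division_ofD(2)[OF p] 1(1) 2(1) K L by fastforce+
  with 1 2 side have *: "u < v" "s < t" "u < x \<longleftrightarrow> s < x"
    by (auto simp: K L)
  have "max u s < min v t" using * x by linarith
  then obtain y where "max u s < y" "y < min v t" using dense by blast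
  then have "y \<in> interior K \<inter> interior L" by (auto simp: K L)
  with disj show False by blast
qed

text \<open>
  At an ordinary point the gauge comes from differentiability. At the exceptional point number
  \<open>i\<close> it comes from the continuity of \<open>f\<close>, which makes the increment of \<open>f\<close> over an interval
  tagged there at most a multiple of \<open>2\<^sup>-\<^sup>i\<close>. As each such tag is used at most twice, the
  exceptional increments have a small sum. On the null set \<open>S\<close> the integrand is first
  replaced by \<open>0\<close>, so that the tags in \<open>S\<close> contribute nothing to the Riemann sums.
\<close>

theorem fundamental_theorem_of_calculus_countable:
  fixes f :: "real \<Rightarrow> 'a::banach"
  assumes "a \<le> b" "countable S" and cont: "continuous_on {a..b} f"
    and vecd: "\<And>x. x \<in> {a..b} - S \<Longrightarrow> (f has_vector_derivative f' x) (at x within {a..b})"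
  shows "(f' has_integral (f b - f a)) {a..b}"
proof (rule has_integral_spike)
  show "negligible S" using \<open>countable S\<close> by (simp add: countable_imp_null_set_lborel negligible_iff_null_sets null_sets_completionI)
  define g where "g x = (if x \<in> S then 0 else f' x)" for x
  show "f' x = g x" if "x \<in> {a..b} - S" for x using that by (simp add: g_def)
  define idx where "idx = to_nat_on S"
  have inj: "inj_on idx S" unfolding idx_def using \<open>countable S\<close> by (rule inj_on_to_nat_on)
  show "(g has_integral (f b - f a)) {a..b}"
    unfolding has_integral_real
  proof (intro allI impI)
    fix e :: real assume "e > 0"
    define \<eta> where "\<eta> = e / (2 * (b - a + 1))"
    have "\<eta> > 0" using \<open>e > 0\<close> \<open>a \<le> b\<close> by (simp add: \<eta>_def)
    have eta_le: "\<eta> * (b - a) \<le> e / 2"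
      using \<open>e > 0\<close> \<open>a \<le> b\<close> by (simp add: \<eta>_def field_simps)
    \<comment> \<open>The total weight is at most \<open>e / 4\<close>, as every weight is used at most twice.\<close>
    define w where "w x = e / 8 * (1/2) ^ Suc (idx x)" for x
    have w: "w x > 0" for x using \<open>e > 0\<close> by (simp add: w_def)
    have "\<exists>d>0. x \<in> {a..b} \<longrightarrow> (\<forall>y\<in>{a..b}. norm (y - x) < d \<longrightarrow>
            norm (f y - f x - (y - x) *\<^sub>R g x) \<le> (if x \<in> S then w x / 2 else \<eta> * norm (y - x)))" for x
    proof (cases "x \<in> {a..b}")
      case x: True
      show ?thesis
      proof (cases "x \<in> S")
        case True
        obtain d where "d > 0" "\<And>y. y \<in> {a..b} \<Longrightarrow> norm (y - x) < d \<Longrightarrow> norm (f y - f x) < w x / 2"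
          using cont x w[of x] unfolding continuous_on_iff dist_norm by (metis half_gt_zero)
        then show ?thesis using True by (intro exI[of _ d]) (auto simp: g_def less_imp_le)
      next
        case False
        with vecd[of x] x \<open>\<eta> > 0\<close> show ?thesis
          unfolding has_vector_derivative_def has_derivative_within_alt by (auto simp: g_def)
      qed
    qed (auto intro: exI[of _ 1])
    then obtain d where d0: "\<And>x. 0 < d x" and d: "\<And>x y. \<lbrakk>x \<in> {a..b}; y \<in> {a..b}; norm (y-x) < d x\<rbrakk>
        \<Longrightarrow> norm (f y - f x - (y - x) *\<^sub>R g x) \<le> (if x \<in> S then w x / 2 else \<eta> * norm (y - x))"
      by metis
    show "\<exists>\<gamma>. gauge \<gamma> \<and> (\<forall>\<D>. \<D> tagged_division_of {a..b} \<and> \<gamma> fine \<D> \<longrightarrow>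
        norm ((\<Sum>(x, K)\<in>\<D>. measure lborel K *\<^sub>R g x) - (f b - f a)) < e)"
    proof (intro exI[of _ "\<lambda>x. ball x (d x)"] conjI allI impI; (elim conjE)?)
      show "gauge (\<lambda>x. ball x (d x))" using d0 by (rule gauge_ball_dependent[rule_format])
      fix p assume p: "p tagged_division_of {a..b}" and fine: "(\<lambda>x. ball x (d x)) fine p"
      define q where "q = {z \<in> p. fst z \<in> S \<and> Inf (snd z) < Sup (snd z)}"
      have fin: "finite p" using p by blast
      have ba: "b - a = (\<Sum>(x,K)\<in>p. Sup K - Inf K)" "f b - f a = (\<Sum>(x,K)\<in>p. f (Sup K) - f (Inf K))"
        using additive_tagged_division_1[OF \<open>a \<le> b\<close> p, of "\<lambda>x. x"]
          additive_tagged_division_1[OF \<open>a \<le> b\<close> p, of f] by auto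
      have term_le: "norm (measure lborel (snd z) *\<^sub>R g (fst z) - (f (Sup (snd z)) - f (Inf (snd z))))
          \<le> \<eta> * (Sup (snd z) - Inf (snd z)) + (if z \<in> q then w (fst z) else 0)" if "z \<in> p" for z
      proof -
        obtain x K where z: "z = (x, K)" by force
        have xK: "(x, K) \<in> p" using that z by simp
        obtain u v where K: "K = {u..v}"
          using tagged_division_ofD(4)[OF p xK] by (metis box_real(2))
        have x: "u \<le> x" "x \<le> v" and sub: "{u..v} \<subseteq> {a..b}"
          using tagged_division_ofD(2,3)[OF p xK] K by auto
        have bd: "\<And>y. y \<in> {u..v} \<Longrightarrow> norm (y - x) < d x"
          using fine xK K by (fastforce simp: fine_def dist_norm norm_minus_commute subset_iff)
        have uv: "norm (f u - f x - (u - x) *\<^sub>R g x) \<le> (if x \<in> S then w x / 2 else \<eta> * norm (u - x))"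
          "norm (f v - f x - (v - x) *\<^sub>R g x) \<le> (if x \<in> S then w x / 2 else \<eta> * norm (v - x))"
          using x sub by (intro d bd; auto)+
        have "norm ((v - u) *\<^sub>R g x - (f v - f u)) =
            norm (f u - f x - (u - x) *\<^sub>R g x - (f v - f x - (v - x) *\<^sub>R g x))"
          by (auto simp: algebra_simps)
        also have "\<dots> \<le> norm (f u - f x - (u - x) *\<^sub>R g x) + norm (f v - f x - (v - x) *\<^sub>R g x)"
          by (rule norm_triangle_ineq4)
        finally have "norm ((v - u) *\<^sub>R g x - (f v - f u)) \<le>
            (if x \<in> S then w x else \<eta> * (v - u))"
          using uv x by (auto split: if_splits simp: algebra_simps)
        then have le: "norm (measure lborel K *\<^sub>R g x - (f (Sup K) - f (Inf K))) \<le>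
            (if x \<in> S then w x else \<eta> * (v - u))"
          using x by (simp add: K)
        have nonneg: "0 \<le> \<eta> * (v - u)" using x \<open>\<eta> > 0\<close> by auto
        have eqK: "\<eta> * (Sup K - Inf K) = \<eta> * (v - u)" using x by (simp add: K)
        consider "u = v" | "u < v" "x \<in> S" | "x \<notin> S" using x by linarith
        then show ?thesis
        proof cases
          case 1
          then have "(x, K) \<notin> q" by (simp add: q_def K)
          then show ?thesis using 1 by (simp add: z K)
        next
          case 2
          have in_q: "(x, K) \<in> q" using 2 xK by (simp add: q_def K)
          have "norm (measure lborel K *\<^sub>R g x - (f (Sup K) - f (Inf K))) \<le> w x"
            using le 2 by (simp only: if_True)
          then show ?thesis unfolding z fst_conv snd_conv eqK if_P[OF in_q] using nonneg by linarith
        next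
          case 3
          have notin_q: "(x, K) \<notin> q" using 3 by (simp add: q_def)
          have "norm (measure lborel K *\<^sub>R g x - (f (Sup K) - f (Inf K))) \<le> \<eta> * (v - u)"
            using le 3 by (simp only: if_False)
          then show ?thesis unfolding z fst_conv snd_conv eqK if_not_P[OF notin_q] by (simp only: add_0_right)
        qed
      qed
      have "inj_on (\<lambda>z. (idx (fst z), Inf (snd z) < fst z)) q"
      proof (rule inj_onI)
        fix z z' assume z: "z \<in> q" "z' \<in> q"
          and eq: "(idx (fst z), Inf (snd z) < fst z) = (idx (fst z'), Inf (snd z') < fst z')"
        have "fst z = fst z'"
          using inj_onD[OF inj, of "fst z" "fst z'"] z eq by (simp add: q_def)
        moreover have "snd z = snd z'"
          using tagged_division_same_tag[OF p, of "fst z" "snd z" "snd z'"] z eq calculation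
          by (simp add: q_def prod_eq_iff[symmetric]) (metis prod.collapse)
        ultimately show "z = z'" by (rule prod_eqI)
      qed
      then have w_le: "(\<Sum>z\<in>q. w (fst z)) \<le> e / 8 * 2"
        using sum_half_powers_le_two[of q "\<lambda>z. (idx (fst z), Inf (snd z) < fst z)"] fin \<open>e > 0\<close>
        by (simp add: w_def q_def flip: sum_distrib_left sum_divide_distrib)
      have "norm ((\<Sum>(x, K)\<in>p. measure lborel K *\<^sub>R g x) - (f b - f a)) =
          norm (\<Sum>z\<in>p. measure lborel (snd z) *\<^sub>R g (fst z) - (f (Sup (snd z)) - f (Inf (snd z))))"
        by (simp add: ba split_def sum_subtractf)
      also have "\<dots> \<le> (\<Sum>z\<in>p. \<eta> * (Sup (snd z) - Inf (snd z)) + (if z \<in> q then w (fst z) else 0))"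
        by (intro sum_norm_le term_le)
      also have "\<dots> = \<eta> * (b - a) + (\<Sum>z\<in>q. w (fst z))"
        by (simp add: ba sum.distrib split_def flip: sum_distrib_left)
           (simp add: sum.If_cases fin q_def Int_def)
      also have "\<dots> < e" using eta_le w_le \<open>e > 0\<close> by linarith
      finally show "norm ((\<Sum>(x, K)\<in>p. measure lborel K *\<^sub>R g x) - (f b - f a)) < e" .
    qed
  qed
qed

section \<open>Improper integrals over the half line\<close>

text \<open>
  The definition of the Henstock--Kurzweil integral over an unbounded set is itself a limit along
  growing boxes. So this holds for conditionally convergent integrals as well.
\<close>

lemma has_integral_half_line_iff:
  fixes g :: "real \<Rightarrow> 'a::banach"
  shows "(g has_integral l) {0..} \<longleftrightarrow>
    (\<forall>x\<ge>0. g integrable_on {0..x}) \<and> ((\<lambda>x. integral {0..x} g) \<longlongrightarrow> l) at_top"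
proof -
  let ?g = "\<lambda>x. if x \<in> {0..} then g x else 0"
  have restrict: "{a..b} \<inter> {0..} = {max a 0..b}" for a b :: real by auto
  have int: "?g integrable_on {a..b} \<longleftrightarrow> g integrable_on {max a 0..b}" for a b
    using integrable_restrict_Int[of "{0..}" g "{a..b}"] by (simp add: restrict Int_commute max.commute)
  have val: "integral {a..b} ?g = integral {max a 0..b} g" for a b
    using integral_restrict_Int[of "{a..b}" "{0..}" g] by (simp add: restrict Int_commute max.commute)
  have integrable_iff: "(\<forall>a b. g integrable_on {max a 0..b}) \<longleftrightarrow> (\<forall>x\<ge>0. g integrable_on {0..x})"
  proof safe
    fix x :: real assume "\<forall>a b. g integrable_on {max a 0..b}"
    then show "g integrable_on {0..x}" by (metis max.idem)
  next
    fix a b :: real assume *: "\<forall>x\<ge>0. g integrable_on {0..x}"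
    show "g integrable_on {max a 0..b}"
    proof (cases "b \<ge> 0")
      case True
      then have "g integrable_on {0..b}" using * by blast
      then show ?thesis by (rule integrable_subinterval_real) auto
    next
      case False
      then have "{max a 0..b} = {}" by auto
      then show ?thesis by (metis integrable_on_empty)
    qed
  qed
  have limit_iff: "(\<forall>e>0. \<exists>B>0. \<forall>a b. ball 0 B \<subseteq> {a..b} \<longrightarrow> norm (integral {max a 0..b} g - l) < e)
      \<longleftrightarrow> ((\<lambda>x. integral {0..x} g) \<longlongrightarrow> l) at_top" (is "?L \<longleftrightarrow> ?R")
  proof
    assume L: ?L
    show ?R
    proof (rule tendstoI)
      fix e :: real assume "e > 0"
      then obtain B where B: "B > 0" "\<And>a b. ball 0 B \<subseteq> {a..b} \<Longrightarrow> norm (integral {max a 0..b} g - l) < e"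
        using L by blast
      have "dist (integral {0..x} g) l < e" if "x \<ge> B" for x
      proof -
        have "ball 0 B \<subseteq> {-B..x}" using that by (auto simp: dist_norm)
        from B(2)[OF this] B(1) show ?thesis by (simp add: dist_norm max_def)
      qed
      then show "\<forall>\<^sub>F x in at_top. dist (integral {0..x} g) l < e"
        by (rule eventually_at_top_linorderI)
    qed
  next
    assume R: ?R
    show ?L
    proof (intro allI impI)
      fix e :: real assume "e > 0"
      then obtain B where B: "\<And>x. x \<ge> B \<Longrightarrow> dist (integral {0..x} g) l < e"
        using R unfolding tendsto_iff eventually_at_top_linorder by blast
      have "norm (integral {max a 0..b} g - l) < e" if "ball 0 (max B 1) \<subseteq> {a..b}" for a b
      proof -
        have "cball 0 (max B 1) \<subseteq> {a..b}"
          using closure_minimal[OF that] by simp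
        moreover have "- max B 1 \<in> cball 0 (max B 1)" "max B 1 \<in> cball 0 (max B 1)"
          by (auto simp: dist_norm)
        ultimately have "- max B 1 \<in> {a..b}" "max B 1 \<in> {a..b}" by blast+
        then have "max a 0 = 0" "B \<le> b" by auto
        with B show ?thesis by (simp add: dist_norm)
      qed
      then show "\<exists>B>0. \<forall>a b. ball 0 B \<subseteq> {a..b} \<longrightarrow> norm (integral {max a 0..b} g - l) < e"
        by (intro exI[of _ "max B 1"]) auto
    qed
  qed
  show ?thesis
    unfolding has_integral_alt'[of g l] box_real int val integrable_iff limit_iff ..
qed

lemma has_integral_half_lineI:
  fixes g :: "real \<Rightarrow> 'a::banach"
  assumes "\<And>x. x \<ge> 0 \<Longrightarrow> (g has_integral F x) {0..x}" and "(F \<longlongrightarrow> l) at_top"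
  shows "(g has_integral l) {0..}"
proof -
  have "\<forall>\<^sub>F x in at_top. F x = integral {0..x} g"
    using assms(1) by (intro eventually_at_top_linorderI[of 0] integral_unique[symmetric])
  with assms(2) have "((\<lambda>x. integral {0..x} g) \<longlongrightarrow> l) at_top"
    by (rule Lim_transform_eventually)
  with assms(1) show ?thesis unfolding has_integral_half_line_iff by blast
qed

section \<open>Limits along a chain of first-order differential equations\<close>

text \<open>
  Nonzero periods of \<open>exp\<close> have modulus at least \<open>2\<pi>\<close>, so a step with \<open>\<bar>r h\<bar> = 1\<close> works.
\<close>

lemma exp_not_one_small:
  fixes r :: complex
  assumes "r \<noteq> 0"
  shows "\<exists>h>0. exp (r * of_real h) \<noteq> 1"
proof (intro exI[of _ "1 / norm r"] conjI notI)
  assume "exp (r * of_real (1 / norm r)) = 1"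
  then obtain m :: int where m: "Re (r * of_real (1 / norm r)) = 0"
    "Im (r * of_real (1 / norm r)) = of_int (2 * m) * pi"
    unfolding exp_eq_1 by auto
  have "1 = norm (r * of_real (1 / norm r))" using assms by (simp add: norm_mult norm_divide)
  also have "\<dots> = \<bar>of_int (2 * m) * pi\<bar>"
    by (subst cmod_def) (use m in auto)
  finally have *: "2 * \<bar>real_of_int m\<bar> * pi = 1" by (simp add: abs_mult)
  then have "m \<noteq> 0" by auto
  then have "1 \<le> \<bar>real_of_int m\<bar>" by linarith
  then have "1 * pi \<le> 2 * \<bar>real_of_int m\<bar> * pi" by (intro mult_right_mono) auto
  then show False using * pi_gt3 by linarith
qed (use assms in auto)

lemma has_vector_derivative_translate:
  assumes "(y has_vector_derivative d) (at (x + h))"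
  shows "((\<lambda>x. y (x + h)) has_vector_derivative d) (at x)"
proof -
  have "((\<lambda>x. x + h) has_vector_derivative 1) (at x)"
    by (auto intro!: derivative_eq_intros)
  from vector_diff_chain_at[OF this assms] show ?thesis by (simp add: o_def)
qed

text \<open>
  Here \<open>(exp (r v) y(u + v))' = exp (r v) Y(u + v)\<close> as a function of \<open>v\<close>. Over the window
  \<open>[0, h]\<close> the factor \<open>Y(u + v)\<close> is uniformly close to \<open>a\<close> when \<open>u\<close> is large, and the
  increment is the integral of the derivative. So a limit of \<open>Y = y' + r y\<close> is passed on to a
  finite difference of \<open>y\<close>, although \<open>y\<close> itself need not converge.
\<close>

lemma exp_weighted_increment_tendsto:
  fixes y :: "real \<Rightarrow> complex" and r a :: complex
  assumes "h > 0"
    and der: "\<And>u. u > 0 \<Longrightarrow> (y has_vector_derivative (Y u - r * y u)) (at u)"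
    and lim: "(Y \<longlongrightarrow> a) at_top"
    and E: "\<And>v. (E has_vector_derivative exp (r * of_real v)) (at v)"
  shows "((\<lambda>u. exp (r * of_real h) * y (u + h) - y u) \<longlongrightarrow> (E h - E 0) * a) at_top"
proof (rule tendstoI)
  fix e :: real assume "e > 0"
  define B where "B = exp (norm r * h)"
  define \<delta> where "\<delta> = e / (2 * B * h)"
  have "B > 0" "\<delta> > 0" using \<open>e > 0\<close> \<open>h > 0\<close> by (auto simp: B_def \<delta>_def)
  have close: "dist (exp (r * of_real h) * y (u + h) - y u) ((E h - E 0) * a) < e"
    if "u > 0" and u: "\<And>v. v \<ge> u \<Longrightarrow> dist (Y v) a < \<delta>" for u
  proof -
    define \<phi> where "\<phi> v = exp (r * of_real v) * y (v + u) - E v * a" for v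
    have d\<phi>: "(\<phi> has_vector_derivative (exp (r * of_real v) * (Y (v + u) - a))) (at v)" if "v \<ge> 0" for v
    proof -
      have "((\<lambda>v. y (v + u)) has_vector_derivative (Y (v + u) - r * y (v + u))) (at v)"
        using der[of "v + u"] that \<open>u > 0\<close>
        by (intro has_vector_derivative_translate) (simp add: add.commute)
      moreover have "((\<lambda>v. exp (r * of_real v)) has_vector_derivative (r * exp (r * of_real v))) (at v)"
        by (rule has_vector_derivative_real_field) (auto intro!: derivative_eq_intros)
      ultimately show ?thesis
        unfolding \<phi>_def
        by (auto intro!: derivative_eq_intros E simp: algebra_simps)
    qed
    have "norm (\<phi> h - \<phi> 0) \<le> (B * \<delta>) * norm (h - 0)"
    proof (rule differentiable_bound[where S = "{0..h}"])
      fix v assume v: "v \<in> {0..h}"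
      show "(\<phi> has_derivative (\<lambda>x. x *\<^sub>R (exp (r * of_real v) * (Y (v + u) - a)))) (at v within {0..h})"
        using d\<phi>[of v] v by (auto simp: has_vector_derivative_def intro: has_derivative_at_withinI)
      have "Re r * v \<le> norm r * h"
        using v \<open>h > 0\<close> by (intro mult_mono) (auto simp: complex_Re_le_cmod)
      then have "norm (exp (r * of_real v)) \<le> B" by (simp add: B_def)
      moreover have "norm (Y (v + u) - a) \<le> \<delta>" using u[of "v + u"] v by (simp add: dist_norm)
      ultimately have "norm (exp (r * of_real v) * (Y (v + u) - a)) \<le> B * \<delta>"
        unfolding norm_mult using \<open>B > 0\<close> by (intro mult_mono) auto
      then show "onorm (\<lambda>x. x *\<^sub>R (exp (r * of_real v) * (Y (v + u) - a))) \<le> B * \<delta>"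
        by (intro onorm_le) (metis mult.commute mult_right_mono norm_ge_zero norm_scaleR real_norm_def)
    qed (use \<open>h > 0\<close> in auto)
    also have "\<dots> = e / 2" using \<open>B > 0\<close> \<open>h > 0\<close> by (simp add: \<delta>_def)
    also have "\<dots> < e" using \<open>e > 0\<close> by simp
    finally show ?thesis by (simp add: dist_norm \<phi>_def algebra_simps)
  qed
  obtain U where "\<And>u. u \<ge> U \<Longrightarrow> dist (Y u) a < \<delta>"
    using tendstoD[OF lim \<open>\<delta> > 0\<close>] unfolding eventually_at_top_linorder by blast
  then show "\<forall>\<^sub>F u in at_top. dist (exp (r * of_real h) * y (u + h) - y u) ((E h - E 0) * a) < e"
    by (intro eventually_at_top_linorderI[of "max 1 U"] close) auto
qed

text \<open>
  The integral of \<open>exp (r v)\<close> over \<open>[0, h]\<close> can vanish when \<open>r\<close> is purely imaginary. The step \<open>h\<close>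
  is chosen to avoid this, so that one may later divide by the integral.
\<close>

lemma exp_antiderivative_nonzero_increment:
  fixes r :: complex
  obtains E h where "h > 0" "\<And>v. (E has_vector_derivative exp (r * of_real v)) (at v)"
    "E h \<noteq> E 0" "r * (E h - E 0) = exp (r * of_real h) - 1"
proof (cases "r = 0")
  case True
  show ?thesis
    by (rule that[of 1 of_real]) (use True in \<open>auto intro!: derivative_eq_intros\<close>)
next
  case False
  with exp_not_one_small obtain h where h: "h > 0" "exp (r * of_real h) \<noteq> 1" by blast
  show ?thesis
  proof (rule that[of h "\<lambda>v. exp (r * of_real v) / r"])
    show "((\<lambda>v. exp (r * complex_of_real v) / r) has_vector_derivative exp (r * complex_of_real v)) (at v)" for v
      by (rule has_vector_derivative_real_field) (use False in \<open>auto intro!: derivative_eq_intros\<close>)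
  qed (use False h in \<open>auto simp: field_simps\<close>)
qed

text \<open>
  Only the two ends of the chain are assumed to converge, and the conclusion is what one obtains
  by setting all derivatives to zero. The induction removes the last equation: the weighted
  differences \<open>z\<^sub>k(u) = exp (r h) y\<^sub>k(u + h) - y\<^sub>k(u)\<close>, with \<open>r\<close> the coefficient of that equation,
  satisfy the remaining ones, and \<open>z\<close> converges at both ends of the shortened chain.
  The common factor \<open>E h - E 0\<close>, the integral of \<open>exp (r v)\<close> over \<open>[0, h]\<close>, cancels.
\<close>

theorem differential_chain_limit:
  fixes y :: "nat \<Rightarrow> real \<Rightarrow> complex" and r c :: "nat \<Rightarrow> complex"
  assumes der: "\<And>k u. k < n \<Longrightarrow> u > 0 \<Longrightarrow>
      (y k has_vector_derivative (y (Suc k) u - r k * y k u + c k)) (at u)"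
    and b: "(y 0 \<longlongrightarrow> b) at_top" and a: "(y n \<longlongrightarrow> a) at_top"
  shows "a = (\<Prod>k<n. r k) * b - (\<Sum>i<n. c i * (\<Prod>k=Suc i..<n. r k))"
  using assms
proof (induction n arbitrary: y c a b)
  case 0
  then show ?case using tendsto_unique[OF _ 0(3) 0(2)] by simp
next
  case (Suc n)
  obtain E h where h: "h > 0" and E: "\<And>v. (E has_vector_derivative exp (r n * of_real v)) (at v)"
    and E0: "E h \<noteq> E 0" and rE: "r n * (E h - E 0) = exp (r n * of_real h) - 1"
    using exp_antiderivative_nonzero_increment[of "r n"] by metis
  define q where "q = exp (r n * of_real h)"
  define z where "z k u = q * y k (u + h) - y k u" for k u
  have shift: "filterlim (\<lambda>u. u + h) at_top at_top"
    by (rule filterlim_tendsto_add_at_top[OF tendsto_const filterlim_ident, of h, simplified add.commute])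
  have "((\<lambda>u. y (Suc n) u + c n) \<longlongrightarrow> a + c n) at_top"
    using Suc.prems(3) by (intro tendsto_intros)
  moreover have "(y n has_vector_derivative (y (Suc n) u + c n) - r n * y n u) (at u)" if "u > 0" for u
    using Suc.prems(1)[of n u] that by (simp add: algebra_simps)
  ultimately have zn: "(z n \<longlongrightarrow> (E h - E 0) * (a + c n)) at_top"
    unfolding z_def q_def by (intro exp_weighted_increment_tendsto h E)
  have z0: "(z 0 \<longlongrightarrow> q * b - b) at_top"
    unfolding z_def
    by (intro tendsto_intros Suc.prems(2) filterlim_compose[OF Suc.prems(2) shift])
  have "(z k has_vector_derivative (z (Suc k) u - r k * z k u + (q - 1) * c k)) (at u)"
    if "k < n" "u > 0" for k u
  proof -
    note d = Suc.prems(1)[of k]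
    have "((\<lambda>u. y k (u + h)) has_vector_derivative (y (Suc k) (u + h) - r k * y k (u + h) + c k)) (at u)"
      using d[of "u + h"] that h by (intro has_vector_derivative_translate) simp
    then show ?thesis
      unfolding z_def using d[of u] that
      by (auto intro!: derivative_eq_intros simp: algebra_simps)
  qed
  from Suc.IH[of z "\<lambda>k. (q - 1) * c k", OF this z0 zn]
  have "(E h - E 0) * (a + c n) =
      (q - 1) * ((\<Prod>k<n. r k) * b - (\<Sum>i<n. c i * (\<Prod>k=Suc i..<n. r k)))"
    by (simp add: algebra_simps sum_distrib_left)
  also have "q - 1 = (E h - E 0) * r n" using rE by (simp add: q_def mult.commute)
  finally have "a + c n = r n * ((\<Prod>k<n. r k) * b - (\<Sum>i<n. c i * (\<Prod>k=Suc i..<n. r k)))"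
    using E0 by (simp add: mult.assoc)
  moreover have "(\<Sum>i<n. c i * (\<Prod>k=Suc i..<Suc n. r k)) =
      r n * (\<Sum>i<n. c i * (\<Prod>k=Suc i..<n. r k))"
    by (simp add: sum_distrib_left algebra_simps)
  ultimately show ?case by (simp add: algebra_simps)
qed

section \<open>The degenerate Laplace kernel\<close>

context
  fixes lam :: real
  assumes lam: "lam > 0"
begin

lemma one_plus_pos: "t \<ge> 0 \<Longrightarrow> 1 + lam * t > 0"
  using lam by (simp add: add_pos_nonneg)

lemma one_plus_nonzero: "t \<ge> 0 \<Longrightarrow> complex_of_real (1 + lam * t) \<noteq> 0"
  unfolding of_real_eq_0_iff using one_plus_pos[of t] by linarith

lemma kernel_has_vector_derivative:
  assumes "t \<ge> 0"
  shows "(deg_laplace_kernel lam s has_vector_derivative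
           - s * deg_laplace_kernel lam (s + of_real lam) t) (at t)"
proof -
  have "complex_of_real (1 + lam * t) \<notin> \<real>\<^sub>\<le>\<^sub>0"
    using one_plus_pos[OF assms] by (simp add: complex_nonpos_Reals_iff)
  then have "((\<lambda>z. (1 + of_real lam * z) powr (- (s / of_real lam))) has_field_derivative
      - (s / of_real lam) * (1 + of_real lam * of_real t) powr (- (s / of_real lam) - 1) * of_real lam)
      (at (complex_of_real t))"
    by (auto intro!: derivative_eq_intros)
  moreover have "- (s / complex_of_real lam) - 1 = - ((s + of_real lam) / of_real lam)"
    using lam by (simp add: field_simps)
  moreover have "- (s / complex_of_real lam) * of_real lam = - s"
    using lam by simp
  ultimately have "((\<lambda>z. (1 + of_real lam * z) powr (- (s / of_real lam))) has_field_derivative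
      - s * deg_laplace_kernel lam (s + of_real lam) t) (at (complex_of_real t))"
    using lam by (simp add: deg_laplace_kernel_def mult.commute mult.left_commute)
  from has_vector_derivative_real_field[OF this]
  show ?thesis by (simp add: deg_laplace_kernel_def[abs_def])
qed

lemma kernel_continuous_on: "A \<subseteq> {0..} \<Longrightarrow> continuous_on A (deg_laplace_kernel lam s)"
  by (rule continuous_at_imp_continuous_on)
     (auto intro: has_vector_derivative_continuous kernel_has_vector_derivative)

lemma kernel_0: "deg_laplace_kernel lam s 0 = 1"
  by (simp add: deg_laplace_kernel_def)

lemma norm_kernel:
  "t \<ge> 0 \<Longrightarrow> norm (deg_laplace_kernel lam s t) = (1 + lam * t) powr (- (Re s / lam))"
  using one_plus_pos[of t]
  by (simp add: deg_laplace_kernel_def norm_powr_real_powr)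

lemma kernel_shift:
  assumes "t \<ge> 0"
  shows "deg_laplace_kernel lam (s + of_nat k * of_real lam) t =
    complex_of_real (1 + lam * t) powi (- int k) * deg_laplace_kernel lam s t"
proof -
  define w where "w = complex_of_real (1 + lam * t)"
  have w: "w \<noteq> 0" unfolding w_def using one_plus_nonzero[OF assms] .
  have "w powr (- ((s + of_nat k * of_real lam) / of_real lam)) = w powr (- (s / of_real lam) - of_nat k)"
    using lam by (simp add: add_divide_distrib)
  also have "\<dots> = w powi (- int k) * w powr (- (s / of_real lam))"
    using w by (simp add: powr_diff powr_nat power_int_minus divide_inverse)
  finally show ?thesis by (simp only: deg_laplace_kernel_def w_def)
qed

lemma antiderivative_of_continuous:
  fixes g :: "real \<Rightarrow> complex"
  assumes "continuous_on {0..} g" "t > 0"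
  shows "((\<lambda>x. integral {0..x} g) has_vector_derivative g t) (at t)"
proof -
  have "continuous_on {0..t + 1} g" using assms(1) by (rule continuous_on_subset) auto
  then have "((\<lambda>x. integral {0..x} g) has_vector_derivative g t) (at t within {0..t + 1})"
    using assms(2) by (intro integral_has_vector_derivative) auto
  moreover have "at t within {0..t + 1} = at t"
    using assms(2) by (intro at_within_interior) auto
  ultimately show ?thesis by simp
qed

text \<open>
  The right-hand side, as a function of \<open>x\<close>, has derivative \<open>K\<^sub>s g'\<close> outside \<open>S\<close>, because the
  derivative of the kernel in the boundary term cancels against that of the last term. As this
  antiderivative is continuous at \<open>0\<close>, \<open>K\<^sub>s g'\<close> is integrable up to \<open>0\<close>.
\<close>

lemma kernel_by_parts:
  assumes S: "countable S" and g: "continuous_on {0..} g"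
    and der: "\<And>t. t > 0 \<Longrightarrow> t \<notin> S \<Longrightarrow> (g has_vector_derivative g' t) (at t)"
    and "x \<ge> 0"
  shows "((\<lambda>t. deg_laplace_kernel lam s t * g' t) has_integral
    (deg_laplace_kernel lam s x * g x - g 0
      + s * integral {0..x} (\<lambda>t. deg_laplace_kernel lam (s + of_real lam) t * g t))) {0..x}"
proof -
  define I where "I x = integral {0..x} (\<lambda>t. deg_laplace_kernel lam (s + of_real lam) t * g t)" for x
  define F where "F t = deg_laplace_kernel lam s t * g t + s * I t" for t
  have cont: "continuous_on {0..} (\<lambda>t. deg_laplace_kernel lam z t * g t)" for z
    by (intro continuous_intros kernel_continuous_on g) auto
  have "(I has_vector_derivative deg_laplace_kernel lam (s + of_real lam) t * g t) (at t)" if "t > 0" for t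
    unfolding I_def using antiderivative_of_continuous[OF cont that] .
  then have "(F has_vector_derivative deg_laplace_kernel lam s t * g' t) (at t)" if "t > 0" "t \<notin> S" for t
    unfolding F_def using that
    by (auto intro!: derivative_eq_intros kernel_has_vector_derivative der simp: algebra_simps)
  moreover have "continuous_on {0..x} F"
    unfolding F_def I_def
    by (intro continuous_intros indefinite_integral_continuous_1 integrable_continuous_real
        continuous_on_subset[OF cont]) auto
  ultimately have "((\<lambda>t. deg_laplace_kernel lam s t * g' t) has_integral F x - F 0) {0..x}"
    using S \<open>x \<ge> 0\<close>
    by (intro fundamental_theorem_of_calculus_countable[of _ _ "insert 0 S"])
       (auto intro: has_vector_derivative_at_within)
  then show ?thesis by (simp add: F_def I_def kernel_0 algebra_simps)
qed

section \<open>Convergence for large real part\<close>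

lemma exp_order_global_bound:
  assumes g: "continuous_on {0..} g" and ord: "deg_exp_order_of lam C g"
  shows "\<exists>M. \<forall>t\<ge>0. norm (g t) \<le> M * (1 + lam * t) powr (C / lam)"
proof -
  obtain M T where M: "M > 0" "T > 0" "\<And>t. t > T \<Longrightarrow> norm (g t) \<le> M * (1 + lam * t) powr (C / lam)"
    and "C > 0" using ord unfolding deg_exp_order_of_def by blast
  have "compact (g ` {0..T})"
    by (intro compact_continuous_image continuous_on_subset[OF g]) auto
  then obtain B where B: "\<And>t. t \<in> {0..T} \<Longrightarrow> norm (g t) \<le> B"
    by (metis bounded_iff compact_imp_bounded imageI)
  have "norm (g t) \<le> max M B * (1 + lam * t) powr (C / lam)" if "t \<ge> 0" for t
  proof (cases "t > T")
    case True
    then show ?thesis using M(3)[OF True] by (meson max.cobounded1 mult_right_mono order_trans powr_ge_zero)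
  next
    case False
    have "1 \<le> (1 + lam * t) powr (C / lam)"
      using lam \<open>C > 0\<close> that by (intro ge_one_powr_ge_zero) auto
    then have "max M B * 1 \<le> max M B * (1 + lam * t) powr (C / lam)"
      using M(1) by (intro mult_left_mono) auto
    moreover have "norm (g t) \<le> B" using B[of t] False that by auto
    ultimately show ?thesis by linarith
  qed
  then show ?thesis by blast
qed

text \<open>
  The margin \<open>2\<lambda>\<close> is chosen for simplicity: any margin above \<open>\<lambda>\<close> would give an integrable
  majorant, and the exponent \<open>2\<close> has an elementary antiderivative.
\<close>

lemma kernel_mult_bound:
  assumes g: "continuous_on {0..} g" and ord: "deg_exp_order_of lam C g" and s: "Re s \<ge> C + 2 * lam"
  obtains M where "\<And>t. t \<ge> 0 \<Longrightarrow> norm (deg_laplace_kernel lam s t * g t) \<le> M / (1 + lam * t)\<^sup>2"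
proof -
  obtain M where M: "\<And>t. t \<ge> 0 \<Longrightarrow> norm (g t) \<le> M * (1 + lam * t) powr (C / lam)"
    using exp_order_global_bound[OF g ord] by blast
  from M[of 0] have "M \<ge> 0" by (simp add: order_trans[OF norm_ge_zero])
  show ?thesis
  proof
    fix t :: real assume t: "t \<ge> 0"
    have "norm (deg_laplace_kernel lam s t * g t)
        \<le> (1 + lam * t) powr (- (Re s / lam)) * (M * (1 + lam * t) powr (C / lam))"
      unfolding norm_mult norm_kernel[OF t] by (intro mult_left_mono M t) auto
    also have "\<dots> = M * (1 + lam * t) powr ((C - Re s) / lam)"
      by (simp add: powr_add[symmetric] diff_divide_distrib)
    also have "\<dots> \<le> M * (1 + lam * t) powr (- 2)"
      using \<open>M \<ge> 0\<close> lam s t by (intro mult_left_mono powr_mono) (auto simp: field_simps)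
    also have "\<dots> = M / (1 + lam * t)\<^sup>2"
      using one_plus_pos[OF t] by (simp add: powr_minus divide_inverse)
    finally show "norm (deg_laplace_kernel lam s t * g t) \<le> M / (1 + lam * t)\<^sup>2" .
  qed
qed

lemma one_plus_at_top: "filterlim (\<lambda>t. 1 + lam * t) at_top at_top"
  by (intro filterlim_tendsto_add_at_top[OF tendsto_const]
      filterlim_tendsto_pos_mult_at_top[OF tendsto_const lam] filterlim_ident)

lemma inverse_square_tendsto_0: "((\<lambda>t. M / (1 + lam * t)\<^sup>2) \<longlongrightarrow> 0) at_top"
  by (intro real_tendsto_divide_at_top[OF tendsto_const] filterlim_pow_at_top one_plus_at_top) simp

lemma inverse_square_integrable: "(\<lambda>t. M / (1 + lam * t)\<^sup>2) integrable_on {0..}"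
proof -
  have int: "((\<lambda>t. M / (1 + lam * t)\<^sup>2) has_integral (- M / (lam * (1 + lam * x)) - - M / (lam * (1 + lam * 0)))) {0..x}"
    if "x \<ge> 0" for x
  proof (rule fundamental_theorem_of_calculus[OF that])
    fix t assume "t \<in> {0..x}"
    with one_plus_pos[of t] have "1 + lam * t \<noteq> 0" by auto
    then have "((\<lambda>t. - M / lam * inverse (1 + lam * t)) has_field_derivative M / (1 + lam * t)\<^sup>2) (at t within {0..x})"
      using lam by (auto intro!: derivative_eq_intros simp: power2_eq_square divide_inverse)
    then show "((\<lambda>t. - M / (lam * (1 + lam * t))) has_vector_derivative M / (1 + lam * t)\<^sup>2) (at t within {0..x})"
      unfolding has_real_derivative_iff_has_vector_derivative[symmetric]
      by (simp add: divide_inverse mult.assoc)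
  qed
  have "filterlim (\<lambda>x. lam * (1 + lam * x)) at_top at_top"
    by (intro filterlim_tendsto_pos_mult_at_top[OF tendsto_const lam] one_plus_at_top)
  then have "((\<lambda>x. - M / (lam * (1 + lam * x)) - - M / (lam * (1 + lam * 0)))
      \<longlongrightarrow> 0 - - M / (lam * (1 + lam * 0))) at_top"
    by (intro tendsto_diff real_tendsto_divide_at_top[OF tendsto_const] tendsto_const)
  from has_integral_half_lineI[OF int this] show ?thesis by (rule has_integral_integrable)
qed

lemma kernel_mult_integrable:
  assumes g: "continuous_on {0..} g" and ord: "deg_exp_order_of lam C g" and s: "Re s \<ge> C + 2 * lam"
  shows "(\<lambda>t. deg_laplace_kernel lam s t * g t) integrable_on {0..}"
proof -
  obtain M where M: "\<And>t. t \<ge> 0 \<Longrightarrow> norm (deg_laplace_kernel lam s t * g t) \<le> M / (1 + lam * t)\<^sup>2"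
    using kernel_mult_bound[OF assms] by blast
  have "continuous_on {0..} (\<lambda>t. deg_laplace_kernel lam s t * g t)"
    by (intro continuous_intros kernel_continuous_on g) auto
  then show ?thesis
    using M
    by (intro measurable_bounded_by_integrable_imp_integrable[OF _ inverse_square_integrable[of M]]
        continuous_imp_measurable_on_sets_lebesgue) auto
qed

lemma kernel_mult_tendsto_0:
  assumes g: "continuous_on {0..} g" and ord: "deg_exp_order_of lam C g" and s: "Re s \<ge> C + 2 * lam"
  shows "((\<lambda>t. deg_laplace_kernel lam s t * g t) \<longlongrightarrow> 0) at_top"
proof -
  obtain M where M: "\<And>t. t \<ge> 0 \<Longrightarrow> norm (deg_laplace_kernel lam s t * g t) \<le> M / (1 + lam * t)\<^sup>2"
    using kernel_mult_bound[OF assms] by blast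
  show ?thesis
    by (rule Lim_null_comparison[OF _ inverse_square_tendsto_0])
       (auto intro!: eventually_at_top_linorderI[of 0] M)
qed

text \<open>
  The growth of \<open>g\<close> suffices, although \<open>g'\<close> may grow arbitrarily fast: by parts, the integral
  is traded for a boundary term tending to \<open>0\<close> and an absolutely convergent integral of \<open>g\<close>.
\<close>

lemma deg_laplace_converges_derivative:
  assumes S: "countable S" and g: "continuous_on {0..} g" and ord: "deg_exp_order_of lam C g"
    and der: "\<And>t. t > 0 \<Longrightarrow> t \<notin> S \<Longrightarrow> (g has_vector_derivative g' t) (at t)"
    and s: "Re s \<ge> C + 2 * lam"
  shows "deg_laplace_converges lam g' s"
proof -
  define I where "I x = integral {0..x} (\<lambda>t. deg_laplace_kernel lam (s + of_real lam) t * g t)" for x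
  obtain l where "(I \<longlongrightarrow> l) at_top"
    using kernel_mult_integrable[OF g ord, of "s + of_real lam"] s lam
    unfolding integrable_on_def has_integral_half_line_iff I_def by auto
  then have "((\<lambda>x. deg_laplace_kernel lam s x * g x - g 0 + s * I x) \<longlongrightarrow> 0 - g 0 + s * l) at_top"
    by (intro tendsto_intros kernel_mult_tendsto_0[OF g ord s])
  moreover have parts: "((\<lambda>t. deg_laplace_kernel lam s t * g' t) has_integral
      (deg_laplace_kernel lam s x * g x - g 0 + s * I x)) {0..x}" if "x \<ge> 0" for x
    unfolding I_def by (rule kernel_by_parts[OF S g der that])
  ultimately show ?thesis
    unfolding deg_laplace_converges_def
    by (intro has_integral_integrable[OF has_integral_half_lineI[OF parts]])
qed

section \<open>The transform of an iterated derivative\<close>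

text \<open>
  A factor \<open>(1 + \<lambda>t)\<^sup>-\<^sup>n\<close> is absorbed by the kernel as a shift of \<open>s\<close> by \<open>n\<lambda>\<close>.
\<close>

lemma deg_laplace_converges_times_power:
  "deg_laplace_converges lam (\<lambda>t. complex_of_real (1 + lam * t) powi (- int n) * g t) s \<longleftrightarrow>
    deg_laplace_converges lam g (s + of_nat n * of_real lam)"
  unfolding deg_laplace_converges_def
  by (intro integrable_cong) (simp add: kernel_shift mult_ac)

lemma deg_laplace_times_power:
  "deg_laplace lam (\<lambda>t. complex_of_real (1 + lam * t) powi (- int n) * g t) s =
    deg_laplace lam g (s + of_nat n * of_real lam)"
  unfolding deg_laplace_def
  by (intro integral_cong) (simp add: kernel_shift mult_ac)

text \<open>
  The truncated integrals \<open>y\<^sub>k\<close> form a differential chain in the logarithmic variable \<open>u\<close> with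
  \<open>1 + \<lambda>x = exp (\<lambda>u)\<close>. The convergence of the two extreme transforms
  supplies the two limits that \<open>differential_chain_limit\<close> needs.
\<close>

theorem deg_laplace_iterated_derivative:
  fixes g :: "nat \<Rightarrow> real \<Rightarrow> complex"
  assumes S: "countable S" and cont: "\<And>k. k < n \<Longrightarrow> continuous_on {0..} (g k)"
    and der: "\<And>k t. k < n \<Longrightarrow> t > 0 \<Longrightarrow> t \<notin> S \<Longrightarrow> (g k has_vector_derivative g (Suc k) t) (at t)"
    and conv_n: "deg_laplace_converges lam (g n) s"
    and conv_0: "deg_laplace_converges lam (g 0) (s + of_nat n * of_real lam)"
  shows "deg_laplace lam (g n) s =
    (\<Prod>k<n. s + of_nat (n - Suc k) * of_real lam) * deg_laplace lam (g 0) (s + of_nat n * of_real lam)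
    - (\<Sum>i<n. g i 0 * (\<Prod>k=Suc i..<n. s + of_nat (n - Suc k) * of_real lam))"
proof -
  define K where "K k = deg_laplace_kernel lam (s + of_nat (n - k) * of_real lam)" for k
  define r where "r k = s + of_nat (n - Suc k) * complex_of_real lam" for k
  define y where "y k x = integral {0..x} (\<lambda>t. K k t * g k t)" for k x
  define \<tau> where "\<tau> u = (exp (lam * u) - 1) / lam" for u
  have \<tau>: "\<tau> u > 0" "1 + lam * \<tau> u = exp (lam * u)" if "u > 0" for u
    using lam that by (auto simp: \<tau>_def)
  have "\<tau> u \<ge> u" for u
    using exp_ge_add_one_self[of "lam * u"] lam by (simp add: \<tau>_def field_simps)
  then have \<tau>_top: "filterlim \<tau> at_top at_top"
    by (intro filterlim_at_top_mono[OF filterlim_ident]) (auto intro: always_eventually)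
  have step: "y (Suc k) x = K (Suc k) x * g k x - g k 0 + r k * y k x" if "k < n" "x \<ge> 0" for k x
  proof -
    have "r k + of_real lam = s + of_nat (n - k) * of_real lam"
      using that unfolding r_def by (simp add: Suc_diff_Suc[OF that(1), symmetric] algebra_simps)
    then have "deg_laplace_kernel lam (r k + of_real lam) = K k" "deg_laplace_kernel lam (r k) = K (Suc k)"
      by (simp_all add: K_def) (simp add: r_def)
    then show ?thesis
      using kernel_by_parts[OF S cont[OF that(1)] der[OF that(1)] that(2), of "r k"]
      by (simp add: y_def integral_unique)
  qed
  \<comment> \<open>This identifies the boundary term of \<open>step\<close> with \<open>(1 + \<lambda>x)\<close> times the derivative of \<open>y k\<close>.\<close>
  have K_step: "of_real (1 + lam * x) * K k x = K (Suc k) x" if "k < n" "x \<ge> 0" for k x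
  proof -
    have "s + of_nat (n - k) * complex_of_real lam = r k + of_nat 1 * of_real lam"
      unfolding r_def by (simp add: Suc_diff_Suc[OF that(1), symmetric] algebra_simps)
    then have "K k x = inverse (of_real (1 + lam * x)) * K (Suc k) x"
      using kernel_shift[OF that(2), of "r k" 1] 
      by (simp add: K_def power_int_minus r_def add.assoc del: of_real_add of_real_mult)
    then show ?thesis using one_plus_nonzero[OF that(2)] by (metis mult.assoc right_inverse mult_1_left)
  qed
  have "((\<lambda>u. y k (\<tau> u)) has_vector_derivative y (Suc k) (\<tau> u) - r k * y k (\<tau> u) + g k 0) (at u)"
    if "k < n" "u > 0" for k u
  proof -
    have "(\<tau> has_vector_derivative exp (lam * u)) (at u)"
      unfolding \<tau>_def has_real_derivative_iff_has_vector_derivative[symmetric]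
      using lam by (auto intro!: derivative_eq_intros)
    moreover have "continuous_on {0..} (\<lambda>t. K k t * g k t)"
      unfolding K_def by (intro continuous_intros kernel_continuous_on cont that) auto
    then have "(y k has_vector_derivative K k (\<tau> u) * g k (\<tau> u)) (at (\<tau> u))"
      unfolding y_def using \<tau>(1)[OF that(2)] by (rule antiderivative_of_continuous)
    ultimately have "((\<lambda>u. y k (\<tau> u)) has_vector_derivative exp (lam * u) *\<^sub>R (K k (\<tau> u) * g k (\<tau> u))) (at u)"
      using vector_diff_chain_at[of \<tau> _ u "y k"] by (simp add: o_def)
    also have "exp (lam * u) *\<^sub>R (K k (\<tau> u) * g k (\<tau> u)) = K (Suc k) (\<tau> u) * g k (\<tau> u)"
      using K_step[OF that(1), of "\<tau> u"] \<tau>[OF that(2)] by (simp add: scaleR_conv_of_real mult.assoc[symmetric])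
    also have "\<dots> = y (Suc k) (\<tau> u) - r k * y k (\<tau> u) + g k 0"
      using step[OF that(1), of "\<tau> u"] \<tau>(1)[OF that(2)] by simp
    finally show ?thesis .
  qed
  moreover have "((\<lambda>u. y 0 (\<tau> u)) \<longlongrightarrow> deg_laplace lam (g 0) (s + of_nat n * of_real lam)) at_top"
    using integrable_integral[OF conv_0[unfolded deg_laplace_converges_def]]
    unfolding has_integral_half_line_iff
    by (intro filterlim_compose[OF _ \<tau>_top]) (simp add: y_def[abs_def] K_def deg_laplace_def)
  moreover have "((\<lambda>u. y n (\<tau> u)) \<longlongrightarrow> deg_laplace lam (g n) s) at_top"
    using integrable_integral[OF conv_n[unfolded deg_laplace_converges_def]]
    unfolding has_integral_half_line_iff
    by (intro filterlim_compose[OF _ \<tau>_top]) (simp add: y_def[abs_def] K_def deg_laplace_def)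
  ultimately show ?thesis
    unfolding r_def[symmetric] by (rule differential_chain_limit[where y = "\<lambda>k u. y k (\<tau> u)"])
qed

end

lemma half_line_deriv_works:
  assumes "t > 0" "g differentiable (at t)"
  shows "(g has_vector_derivative half_line_deriv g t) (at t)"
proof -
  have "at t within {0..} = at t" using assms(1) by (intro at_within_interior) simp
  then show ?thesis using assms(2) by (simp add: half_line_deriv_def vector_derivative_works)
qed

text \<open>
  Finiteness holds only on compact subintervals of the open half line, so the exceptions may
  accumulate at \<open>0\<close> and at infinity, but exhausting the half line shows that they are countable.
\<close>

lemma piecewise_continuous_pos_countable_exceptions:
  assumes "piecewise_continuous_pos D g"
  shows "countable {t. t > 0 \<and> t \<notin> D}"
proof -
  have "{t. t > 0 \<and> t \<notin> D} \<subseteq> (\<Union>m. {t \<in> {1 / real (Suc m)..real (Suc m)}. t \<notin> D \<or> \<not> isCont g t})"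
  proof safe
    fix t :: real assume t: "t > 0" "t \<notin> D"
    obtain m1 m2 where m: "1 / real (Suc m1) < t" "t < real m2"
      using t(1) reals_Archimedean reals_Archimedean2 by (metis inverse_eq_divide)
    define m where "m = max m1 m2"
    have "1 / real (Suc m) \<le> 1 / real (Suc m1)" "real m2 \<le> real (Suc m)"
      by (auto simp: m_def intro!: divide_left_mono)
    then show "t \<in> (\<Union>m. {t \<in> {1 / real (Suc m)..real (Suc m)}. t \<notin> D \<or> \<not> isCont g t})"
      using m t(2) by (intro UN_I[of m]) auto
  qed
  moreover have "finite {t \<in> {1 / real (Suc m)..real (Suc m)}. t \<notin> D \<or> \<not> isCont g t}" for m
    using assms[unfolded piecewise_continuous_pos_def, THEN conjunct1, rule_format, of "1 / real (Suc m)" "real (Suc m)"]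
    by simp
  from countable_finite[OF this]
  have "countable (\<Union>m. {t \<in> {1 / real (Suc m)..real (Suc m)}. t \<notin> D \<or> \<not> isCont g t})"
    by (rule countable_UN[OF countableI_type])
  ultimately show ?thesis by (rule countable_subset)
qed

theorem theorem3p3:
  fixes lam :: real and n :: nat and f :: "real \<Rightarrow> complex"
  assumes "lam > 0" and "n \<ge> 1"
    and "\<And>i. i < n - 1 \<Longrightarrow> nth_deriv i f differentiable_on {0..}"
    and "\<And>i. i < n \<Longrightarrow> continuous_on {0..} (nth_deriv i f)"
    and "\<And>i. i < n \<Longrightarrow> deg_exp_order lam (nth_deriv i f)"
    and "piecewise_continuous_pos {t. nth_deriv (n - 1) f differentiable (at t)} (nth_deriv n f)"
  shows "(\<exists>\<sigma>::real. \<forall>s::complex. Re s > \<sigma> \<longrightarrow>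
            deg_laplace_converges lam (nth_deriv n f) s \<and>
            deg_laplace_converges lam (\<lambda>t. complex_of_real (1 + lam * t) powi (- int n) * f t) s) \<and>
         (\<forall>s::complex.
            deg_laplace_converges lam (nth_deriv n f) s \<and>
            deg_laplace_converges lam (\<lambda>t. complex_of_real (1 + lam * t) powi (- int n) * f t) s \<longrightarrow>
            deg_laplace lam (nth_deriv n f) s =
              (\<Prod>k<n. s + of_nat k * complex_of_real lam) *
                deg_laplace lam (\<lambda>t. complex_of_real (1 + lam * t) powi (- int n) * f t) s
              - (\<Sum>i<n. nth_deriv i f 0 *
                   (\<Prod>l=1..n-i-1. s + of_nat (l - 1) * complex_of_real lam)))"
proof -
  define S where "S = {t. t > 0 \<and> t \<notin> {t. nth_deriv (n - 1) f differentiable (at t)}}"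
  have S: "countable S"
    unfolding S_def by (rule piecewise_continuous_pos_countable_exceptions[OF assms(6)])
  have der: "(nth_deriv k f has_vector_derivative nth_deriv (Suc k) f t) (at t)"
    if "k < n" "t > 0" "t \<notin> S" for k t
  proof -
    have "nth_deriv k f differentiable (at t)"
    proof (cases "k = n - 1")
      case True
      then show ?thesis using that by (simp add: S_def)
    next
      case False
      then have "nth_deriv k f differentiable (at t within {0..})"
        using assms(3)[of k] that by (auto simp: differentiable_on_def)
      moreover have "at t within {0..} = at t" using that(2) by (intro at_within_interior) simp
      ultimately show ?thesis by simp
    qed
    then show ?thesis using half_line_deriv_works[OF that(2)] by simp
  qed
  obtain C where C: "deg_exp_order_of lam C f"
    using assms(2) assms(5)[of 0] by (auto simp: deg_exp_order_def)
  obtain C' where C': "deg_exp_order_of lam C' (nth_deriv (n - 1) f)"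
    using assms(2) assms(5)[of "n - 1"] by (auto simp: deg_exp_order_def)
  have convergence: "deg_laplace_converges lam (nth_deriv n f) s \<and>
      deg_laplace_converges lam (\<lambda>t. complex_of_real (1 + lam * t) powi (- int n) * f t) s"
    if s: "Re s > max C C' + 2 * lam" for s
  proof
    show "deg_laplace_converges lam (nth_deriv n f) s"
      using assms(2) s der[of "n - 1"]
      by (intro deg_laplace_converges_derivative[OF assms(1) S assms(4)[of "n - 1"] C']) auto
    have "Re (s + of_nat n * of_real lam) \<ge> C + 2 * lam"
      using s assms(1) by (simp add: add_increasing2)
    then show "deg_laplace_converges lam (\<lambda>t. complex_of_real (1 + lam * t) powi (- int n) * f t) s"
      unfolding deg_laplace_converges_times_power[OF assms(1)]
      using kernel_mult_integrable[OF assms(1) _ C] assms(2) assms(4)[of 0]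
      by (auto simp: deg_laplace_converges_def)
  qed
  have identity: "deg_laplace lam (nth_deriv n f) s =
      (\<Prod>k<n. s + of_nat k * complex_of_real lam) *
        deg_laplace lam (\<lambda>t. complex_of_real (1 + lam * t) powi (- int n) * f t) s
      - (\<Sum>i<n. nth_deriv i f 0 * (\<Prod>l=1..n-i-1. s + of_nat (l - 1) * complex_of_real lam))"
    if conv: "deg_laplace_converges lam (nth_deriv n f) s"
      "deg_laplace_converges lam (\<lambda>t. complex_of_real (1 + lam * t) powi (- int n) * f t) s" for s
  proof -
    \<comment> \<open>The factors for \<open>k\<close> and \<open>l\<close> correspond via \<open>k + l = n\<close>.\<close>
    have prod_tail: "(\<Prod>k=Suc i..<n. s + of_nat (n - Suc k) * complex_of_real lam) =
        (\<Prod>l=1..n-i-1. s + of_nat (l - 1) * complex_of_real lam)" for i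
      by (rule prod.reindex_bij_witness[of _ "\<lambda>l. n - l" "\<lambda>k. n - k"]) auto
    have prod_all: "(\<Prod>k<n. s + of_nat (n - Suc k) * complex_of_real lam) =
        (\<Prod>k<n. s + of_nat k * complex_of_real lam)"
      by (rule prod.nat_diff_reindex)
    have "deg_laplace_converges lam (nth_deriv 0 f) (s + of_nat n * of_real lam)"
      using conv(2) unfolding deg_laplace_converges_times_power[OF assms(1)] funpow_0 .
    note * = deg_laplace_iterated_derivative[where g = "\<lambda>k. nth_deriv k f", OF assms(1) S assms(4) der conv(1) this]
    show ?thesis
      unfolding deg_laplace_times_power[OF assms(1)]
      using *[unfolded prod_tail prod_all funpow_0] .
  qed
  show ?thesis
    by (rule conjI, rule exI[of _ "max C C' + 2 * lam"], intro allI impI, erule convergence,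
        intro allI impI, erule conjE, rule identity)
qed

end
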